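(* Let $p_3^*,p_4^*,p_5^*$ be the optimal values of the problems P3, P4, P5 defined in the context, and let $\tilde p_5^*$ be the optimal value of P5 after the integer constraint $d_{k,u}\in\mathbb N$ is relaxed to $d_{k,u}\in\mathbb R$. Then $p_3^*=p_4^*$ and $$\tilde p_5^*\le p_5^*\le p_4^*;$$ in particular $\tilde p_5^*$ is a lower bound for the optimal total transmit power $p_3^*$ of P3.
   Context: Let $K,U,N,N_{RF}$ be positive integers, and let $G=(V,E)$ be a finite simple undirected graph (interference graph) with $V=\{v_{k,u}:1\le k\le K,1\le u\le U\}$, where $v_{k,u}$ represents user $u$ of cell $k$; the edge joining $v_{k,u}$ and $v_{k',u'}$ is denoted $e_{(k,u),(k',u')}$. Let $W>0$ (bandwidth), $P_{max}>0$, $\gamma_{k,u}>0$ (rate requirements), and $\beta_{k,u}>0$ (channel gain to interference-plus-noise ratios) be given constants. A scheduling is a family of matrices $\boldsymbol S^k=(s^k_{r,n})$, $1\le r\le N_{RF}$, $1\le n\le N$, $1\le k\le K$, where $s^k_{r,n}=u\ne0$ means user $u$ of cell $k$ is served by RF chain $r$ in slot $n$, and $s^k_{r,n}=0$ means that no user is. A power allocation is a family $\boldsymbol P^k=(p^k_{r,n})$ of matrices of the same size. Write $\delta(x,y)=1$ if $x=y$ and $0$ otherwise, and $\lceil x\rceil$ for the least integer not less than $x$. The optimal value of an infeasible minimization problem is $+\infty$. NIF scheduling constraints: (a) $s^k_{r,n}\in\{0,1,\dots,U\}$ for all $k,r,n$; (b) $\delta(s^k_{r,n},s^k_{r',n})=\delta(r,r')$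 whenever $s^k_{r,n}s^k_{r',n}\ne0$, for all $k,r,r',n$; (c) $e_{(k,s^k_{r,n}),(k',s^{k'}_{r',n})}\notin E$ whenever $s^k_{r,n}s^{k'}_{r',n}\ne0$, for all $k,r,k',r',n$. P3: minimize $\sum_{(k,r,n)}p^k_{r,n}$ over $\{\boldsymbol S^k,\boldsymbol P^k\}_{k=1}^K$ subject to (a), (b), (c), $0\le p^k_{r,n}\le P_{max}$ for all $k,r,n$, and $$\frac1N\sum_{(r,n):\,s^k_{r,n}=u}W\log_2(1+\beta_{k,u}p^k_{r,n})\ge\gamma_{k,u}\quad\text{for all }k,u.$$ P4: minimize $\sum_{(k,u)}\frac{\hat d_{k,u}}{\beta_{k,u}}\Big(2^{\frac{\gamma_{k,u}N}{\hat d_{k,u}W}}-1\Big)$ over $\{\boldsymbol S^k\}_{k=1}^K$ subject to (a), (b), (c), where $\hat d_{k,u}=\sum_{(r,n)}\delta(s^k_{r,n},u)$, and $$\Big\lceil\frac{\gamma_{k,u}N}{W\log_2(\beta_{k,u}P_{max}+1)}\Big\rceil\le\hat d_{k,u}\le N\quad\text{for all }k,u.$$ P5: minimize $\sum_{(k,u)}\frac{d_{k,u}}{\beta_{k,u}}\Big(2^{\frac{\gamma_{k,u}N}{d_{k,u}W}}-1\Big)$ over $\{d_{k,u}\}_{k,u}$ subject to $$\Big\lceil\frac{\gamma_{k,u}N}{W\log_2(\beta_{k,u}P_{max}+1)}\Big\rceil\le d_{k,u}\le N,\quad d_{k,u}\in\mathbb N,\quad\text{for all }k,u;$$ $\sum_q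 d_{k_q,u_q}\le N$ for every clique of $G$ with node set $\{v_{k_q,u_q}\}_q$ (a clique is a set of pairwise adjacent nodes); and $\sum_u d_{k,u}\le N_{RF}N$ for all $k$. *)

theory Defs
  imports "HOL-Library.Extended_Real"
begin

text \<open>
  Vertices are pairs \<open>(k, u)\<close>, and an edge is a two-element set of vertices.
\<close>

definition vertices :: "nat \<Rightarrow> nat \<Rightarrow> (nat \<times> nat) set" where
  "vertices K U = {1..K} \<times> {1..U}"

definition simple_graph :: "'v set \<Rightarrow> 'v set set \<Rightarrow> bool" where
  "simple_graph V E \<longleftrightarrow> finite V \<and> (\<forall>e\<in>E. \<exists>x\<in>V. \<exists>y\<in>V. x \<noteq> y \<and> e = {x, y})"

definition clique :: "'v set \<Rightarrow> 'v set set \<Rightarrow> 'v set \<Rightarrow> bool" where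
  "clique V E C \<longleftrightarrow> C \<subseteq> V \<and> (\<forall>x\<in>C. \<forall>y\<in>C. x \<noteq> y \<longrightarrow> {x, y} \<in> E)"

definition delta :: "'a \<Rightarrow> 'a \<Rightarrow> nat" where
  "delta x y = (if x = y then 1 else 0)"

text \<open>
  The infimum is taken in the extended reals, so it is \<open>\<infinity>\<close> if no point is feasible.
\<close>

definition optimal_value :: "('a \<Rightarrow> bool) \<Rightarrow> ('a \<Rightarrow> real) \<Rightarrow> ereal" where
  "optimal_value feasible cost = (INF x\<in>{x. feasible x}. ereal (cost x))"

text \<open>
  A family of matrices is a function of \<open>k\<close>, \<open>r\<close>, \<open>n\<close> (in this order). Values at indices
  outside \<open>{1..K}\<close>, \<open>{1..NRF}\<close>, \<open>{1..N}\<close> are unconstrained and enter no objective; the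
  same convention applies to the families \<open>d\<close> indexed by \<open>k\<close> and \<open>u\<close>.
\<close>

definition nif_scheduling ::
  "nat \<Rightarrow> nat \<Rightarrow> nat \<Rightarrow> nat \<Rightarrow> (nat \<times> nat) set set \<Rightarrow> (nat \<Rightarrow> nat \<Rightarrow> nat \<Rightarrow> nat) \<Rightarrow> bool" where
  "nif_scheduling K U N NRF E S \<longleftrightarrow>
     (\<forall>k\<in>{1..K}. \<forall>r\<in>{1..NRF}. \<forall>n\<in>{1..N}. S k r n \<in> {0..U}) \<and>
     (\<forall>k\<in>{1..K}. \<forall>r\<in>{1..NRF}. \<forall>r'\<in>{1..NRF}. \<forall>n\<in>{1..N}.
        S k r n * S k r' n \<noteq> 0 \<longrightarrow> delta (S k r n) (S k r' n) = delta r r') \<and>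
     (\<forall>k\<in>{1..K}. \<forall>r\<in>{1..NRF}. \<forall>k'\<in>{1..K}. \<forall>r'\<in>{1..NRF}. \<forall>n\<in>{1..N}.
        S k r n * S k' r' n \<noteq> 0 \<longrightarrow> {(k, S k r n), (k', S k' r' n)} \<notin> E)"

definition p3_feasible ::
  "nat \<Rightarrow> nat \<Rightarrow> nat \<Rightarrow> nat \<Rightarrow> (nat \<times> nat) set set \<Rightarrow> real \<Rightarrow> real \<Rightarrow>
   (nat \<Rightarrow> nat \<Rightarrow> real) \<Rightarrow> (nat \<Rightarrow> nat \<Rightarrow> real) \<Rightarrow>
   (nat \<Rightarrow> nat \<Rightarrow> nat \<Rightarrow> nat) \<times> (nat \<Rightarrow> nat \<Rightarrow> nat \<Rightarrow> real) \<Rightarrow> bool" where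
  "p3_feasible K U N NRF E W Pmax \<gamma> \<beta> = (\<lambda>(S, P).
     nif_scheduling K U N NRF E S \<and>
     (\<forall>k\<in>{1..K}. \<forall>r\<in>{1..NRF}. \<forall>n\<in>{1..N}. 0 \<le> P k r n \<and> P k r n \<le> Pmax) \<and>
     (\<forall>k\<in>{1..K}. \<forall>u\<in>{1..U}.
        1 / real N * (\<Sum>(r, n)\<in>{(r, n). r \<in> {1..NRF} \<and> n \<in> {1..N} \<and> S k r n = u}.
          W * log 2 (1 + \<beta> k u * P k r n)) \<ge> \<gamma> k u))"

definition p3_opt ::
  "nat \<Rightarrow> nat \<Rightarrow> nat \<Rightarrow> nat \<Rightarrow> (nat \<times> nat) set set \<Rightarrow> real \<Rightarrow> real \<Rightarrow>
   (nat \<Rightarrow> nat \<Rightarrow> real) \<Rightarrow> (nat \<Rightarrow> nat \<Rightarrow> real) \<Rightarrow> ereal" where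
  "p3_opt K U N NRF E W Pmax \<gamma> \<beta> =
     optimal_value (p3_feasible K U N NRF E W Pmax \<gamma> \<beta>)
       (\<lambda>(S, P). \<Sum>(k, r, n)\<in>{1..K} \<times> {1..NRF} \<times> {1..N}. P k r n)"

definition min_slots :: "nat \<Rightarrow> real \<Rightarrow> real \<Rightarrow> real \<Rightarrow> real \<Rightarrow> int" where
  "min_slots N W Pmax g b = \<lceil>g * real N / (W * log 2 (b * Pmax + 1))\<rceil>"

definition slot_cost ::
  "nat \<Rightarrow> nat \<Rightarrow> nat \<Rightarrow> real \<Rightarrow> (nat \<Rightarrow> nat \<Rightarrow> real) \<Rightarrow> (nat \<Rightarrow> nat \<Rightarrow> real) \<Rightarrow>
   (nat \<Rightarrow> nat \<Rightarrow> real) \<Rightarrow> real" where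
  "slot_cost K U N W \<gamma> \<beta> d =
     (\<Sum>(k, u)\<in>{1..K} \<times> {1..U}. d k u / \<beta> k u * (2 powr (\<gamma> k u * real N / (d k u * W)) - 1))"

definition slots_served ::
  "nat \<Rightarrow> nat \<Rightarrow> (nat \<Rightarrow> nat \<Rightarrow> nat \<Rightarrow> nat) \<Rightarrow> nat \<Rightarrow> nat \<Rightarrow> nat" where
  "slots_served N NRF S k u = (\<Sum>(r, n)\<in>{1..NRF} \<times> {1..N}. delta (S k r n) u)"

definition p4_feasible ::
  "nat \<Rightarrow> nat \<Rightarrow> nat \<Rightarrow> nat \<Rightarrow> (nat \<times> nat) set set \<Rightarrow> real \<Rightarrow> real \<Rightarrow>
   (nat \<Rightarrow> nat \<Rightarrow> real) \<Rightarrow> (nat \<Rightarrow> nat \<Rightarrow> real) \<Rightarrow> (nat \<Rightarrow> nat \<Rightarrow> nat \<Rightarrow> nat) \<Rightarrow> bool" where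
  "p4_feasible K U N NRF E W Pmax \<gamma> \<beta> S \<longleftrightarrow>
     nif_scheduling K U N NRF E S \<and>
     (\<forall>k\<in>{1..K}. \<forall>u\<in>{1..U}.
        min_slots N W Pmax (\<gamma> k u) (\<beta> k u) \<le> int (slots_served N NRF S k u) \<and>
        slots_served N NRF S k u \<le> N)"

definition p4_opt ::
  "nat \<Rightarrow> nat \<Rightarrow> nat \<Rightarrow> nat \<Rightarrow> (nat \<times> nat) set set \<Rightarrow> real \<Rightarrow> real \<Rightarrow>
   (nat \<Rightarrow> nat \<Rightarrow> real) \<Rightarrow> (nat \<Rightarrow> nat \<Rightarrow> real) \<Rightarrow> ereal" where
  "p4_opt K U N NRF E W Pmax \<gamma> \<beta> =
     optimal_value (p4_feasible K U N NRF E W Pmax \<gamma> \<beta>)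
       (\<lambda>S. slot_cost K U N W \<gamma> \<beta> (\<lambda>k u. real (slots_served N NRF S k u)))"

definition p5_relaxed_feasible ::
  "nat \<Rightarrow> nat \<Rightarrow> nat \<Rightarrow> nat \<Rightarrow> (nat \<times> nat) set set \<Rightarrow> real \<Rightarrow> real \<Rightarrow>
   (nat \<Rightarrow> nat \<Rightarrow> real) \<Rightarrow> (nat \<Rightarrow> nat \<Rightarrow> real) \<Rightarrow> (nat \<Rightarrow> nat \<Rightarrow> real) \<Rightarrow> bool" where
  "p5_relaxed_feasible K U N NRF E W Pmax \<gamma> \<beta> d \<longleftrightarrow>
     (\<forall>k\<in>{1..K}. \<forall>u\<in>{1..U}.
        real_of_int (min_slots N W Pmax (\<gamma> k u) (\<beta> k u)) \<le> d k u \<and> d k u \<le> real N) \<and>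
     (\<forall>C. clique (vertices K U) E C \<longrightarrow> (\<Sum>(k, u)\<in>C. d k u) \<le> real N) \<and>
     (\<forall>k\<in>{1..K}. (\<Sum>u\<in>{1..U}. d k u) \<le> real (NRF * N))"

definition p5_feasible ::
  "nat \<Rightarrow> nat \<Rightarrow> nat \<Rightarrow> nat \<Rightarrow> (nat \<times> nat) set set \<Rightarrow> real \<Rightarrow> real \<Rightarrow>
   (nat \<Rightarrow> nat \<Rightarrow> real) \<Rightarrow> (nat \<Rightarrow> nat \<Rightarrow> real) \<Rightarrow> (nat \<Rightarrow> nat \<Rightarrow> real) \<Rightarrow> bool" where
  "p5_feasible K U N NRF E W Pmax \<gamma> \<beta> d \<longleftrightarrow>
     p5_relaxed_feasible K U N NRF E W Pmax \<gamma> \<beta> d \<and>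
     (\<forall>k\<in>{1..K}. \<forall>u\<in>{1..U}. d k u \<in> \<nat>)"

definition p5_opt ::
  "nat \<Rightarrow> nat \<Rightarrow> nat \<Rightarrow> nat \<Rightarrow> (nat \<times> nat) set set \<Rightarrow> real \<Rightarrow> real \<Rightarrow>
   (nat \<Rightarrow> nat \<Rightarrow> real) \<Rightarrow> (nat \<Rightarrow> nat \<Rightarrow> real) \<Rightarrow> ereal" where
  "p5_opt K U N NRF E W Pmax \<gamma> \<beta> =
     optimal_value (p5_feasible K U N NRF E W Pmax \<gamma> \<beta>) (slot_cost K U N W \<gamma> \<beta>)"

definition p5_relaxed_opt ::
  "nat \<Rightarrow> nat \<Rightarrow> nat \<Rightarrow> nat \<Rightarrow> (nat \<times> nat) set set \<Rightarrow> real \<Rightarrow> real \<Rightarrow>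
   (nat \<Rightarrow> nat \<Rightarrow> real) \<Rightarrow> (nat \<Rightarrow> nat \<Rightarrow> real) \<Rightarrow> ereal" where
  "p5_relaxed_opt K U N NRF E W Pmax \<gamma> \<beta> =
     optimal_value (p5_relaxed_feasible K U N NRF E W Pmax \<gamma> \<beta>) (slot_cost K U N W \<gamma> \<beta>)"

end

theory Submission
  imports Defs
begin

text \<open>
  For a user served in \<open>d\<close> slots with rates \<open>y\<^sub>i\<close> (in bits per unit bandwidth), the power spent is
  \<open>\<Sum> (2 powr y\<^sub>i - 1) / \<beta>\<close>. By convexity of the exponential function, equal rates are optimal, so only the
  number \<open>d\<close> matters; this reduces P3 to P4. Conversely, in each slot at most one user of a clique
  is served, and each chain serves at most one user per slot, so the numbers of served
  slots of a feasible schedule satisfy the constraints of P5.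
\<close>

section \<open>Comparison of infima and a convexity inequality\<close>

lemma optimal_value_mono:
  assumes "\<And>x. f x \<Longrightarrow> \<exists>y. g y \<and> c' y \<le> c x"
  shows "optimal_value g c' \<le> optimal_value f c"
  unfolding optimal_value_def
\<comment> \<open>If \<open>f\<close> has no point, its infimum is \<infinity> and there is nothing
  to match. No optimum has to be attained on either side.\<close>
proof (rule INF_mono)
  fix x assume "x \<in> {x. f x}"
  then obtain y where "g y" "c' y \<le> c x" using assms by auto
  then show "\<exists>y\<in>{y. g y}. ereal (c' y) \<le> ereal (c x)" by auto
qed

text \<open>Jensen's inequality for x \<mapsto> \<open>b powr x\<close>, obtained by summing the
  tangent line at \<open>m\<close>. Multiplying through by the cardinality keeps it free of
  division, so an empty \<open>A\<close> is harmless.\<close>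

lemma mult_powr_le_sum_powr:
  fixes b m :: real
  assumes "finite A" "b \<ge> 1" "real (card A) * m \<le> (\<Sum>i\<in>A. y i)"
  shows "real (card A) * b powr m \<le> (\<Sum>i\<in>A. b powr y i)"
proof -
  \<comment> \<open>The line on the left touches the exponential at \<open>m\<close>; the bound is 1
    + t \<le> \<open>exp t\<close> with t = \<open>ln b * (y i - m)\<close>.\<close>
  have tangent: "b powr m * (1 + ln b * (y i - m)) \<le> b powr y i" for i
  proof -
    have "b powr m * (1 + ln b * (y i - m)) \<le> b powr m * exp (ln b * (y i - m))"
      by (intro mult_left_mono exp_ge_add_one_self) auto
    also have "\<dots> = b powr m * b powr (y i - m)"
      using assms(2) by (simp add: powr_def mult.commute)
    also have "\<dots> = b powr y i"
      by (simp add: powr_add[symmetric])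
    finally show ?thesis .
  qed
  \<comment> \<open>Since \<open>ln b\<close> is nonnegative, \<open>m\<close> may be any lower
    bound of the mean instead of the mean itself.\<close>
  have "0 \<le> ln b * ((\<Sum>i\<in>A. y i) - real (card A) * m)"
    using assms(2,3) by simp
  then have "real (card A) * b powr m \<le>
      b powr m * (real (card A) + ln b * ((\<Sum>i\<in>A. y i) - real (card A) * m))"
    by (subst mult.commute) (intro mult_left_mono, auto)
  also have "\<dots> = (\<Sum>i\<in>A. b powr m * (1 + ln b * (y i - m)))"
    by (simp add: sum_distrib_left[symmetric] sum.distrib sum_subtractf)
  also have "\<dots> \<le> (\<Sum>i\<in>A. b powr y i)"
    by (intro sum_mono tangent)
  finally show ?thesis .
qed

section \<open>Counting served slots and feasibility for P5\<close>

definition served :: "nat \<Rightarrow> nat \<Rightarrow> (nat \<Rightarrow> nat \<Rightarrow> nat \<Rightarrow> nat) \<Rightarrow> nat \<Rightarrow> nat \<Rightarrow> (nat \<times> nat) set" where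
  "served N NRF S k u = {(r, n). r \<in> {1..NRF} \<and> n \<in> {1..N} \<and> S k r n = u}"

lemma served_subset: "served N NRF S k u \<subseteq> {1..NRF} \<times> {1..N}"
  by (auto simp: served_def)

lemma finite_served [simp]: "finite (served N NRF S k u)"
  by (rule finite_subset[OF served_subset]) simp

lemma slots_served_eq_card: "slots_served N NRF S k u = card (served N NRF S k u)"
proof -
  have "slots_served N NRF S k u =
      (\<Sum>x\<in>{1..NRF} \<times> {1..N}. if x \<in> served N NRF S k u then 1 else 0)"
    unfolding slots_served_def by (intro sum.cong) (auto simp: delta_def served_def split: if_splits)
  also have "\<dots> = card (({1..NRF} \<times> {1..N}) \<inter> served N NRF S k u)"
    by (simp add: sum.If_cases)
  also have "({1..NRF} \<times> {1..N}) \<inter> served N NRF S k u = served N NRF S k u"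
    using served_subset by blast
  finally show ?thesis .
qed

text \<open>By (a), the fibres of \<open>S k\<close> over 0, ..., \<open>U\<close> partition all
  positions. The fibre of 0 stands apart because P3 does not force idle positions to carry zero
  power.\<close>

lemma sum_power_by_user:
  fixes P :: "nat \<Rightarrow> nat \<Rightarrow> nat \<Rightarrow> real"
  assumes "nif_scheduling K U N NRF E S"
  shows "(\<Sum>(k, r, n)\<in>{1..K} \<times> {1..NRF} \<times> {1..N}. P k r n) =
    (\<Sum>k\<in>{1..K}. \<Sum>(r, n)\<in>served N NRF S k 0. P k r n) +
    (\<Sum>(k, u)\<in>{1..K} \<times> {1..U}. \<Sum>(r, n)\<in>served N NRF S k u. P k r n)"
proof -
  have "(\<Sum>(r, n)\<in>{1..NRF} \<times> {1..N}. P k r n) =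
      (\<Sum>(r, n)\<in>served N NRF S k 0. P k r n) +
      (\<Sum>u\<in>{1..U}. \<Sum>(r, n)\<in>served N NRF S k u. P k r n)" if k: "k \<in> {1..K}" for k
  proof -
    have fibre: "{x \<in> {1..NRF} \<times> {1..N}. (case x of (r, n) \<Rightarrow> S k r n) = u} = served N NRF S k u" for u
      by (auto simp: served_def)
    have "(\<lambda>(r, n). S k r n) ` ({1..NRF} \<times> {1..N}) \<subseteq> {0..U}"
      using assms k by (fastforce simp: nif_scheduling_def)
    then have "(\<Sum>(r, n)\<in>{1..NRF} \<times> {1..N}. P k r n) =
        (\<Sum>u\<in>{0..U}. \<Sum>(r, n)\<in>served N NRF S k u. P k r n)"
      using sum.group[of "{1..NRF} \<times> {1..N}" "{0..U}" "\<lambda>(r, n). S k r n" "\<lambda>(r, n). P k r n"]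
      unfolding fibre by simp
    then show ?thesis
      by (simp add: sum.atLeast_Suc_atMost)
  qed
  then show ?thesis
    by (simp add: sum.cartesian_product[symmetric] sum.distrib[symmetric])
qed

text \<open>Each slot is used by at most one pair of a clique vertex and a chain: (c) excludes two
  vertices, (b) excludes two chains for one vertex. Hence projecting the disjoint union of the
  served positions to the slot is injective.\<close>

lemma sum_slots_served_clique_le:
  assumes nif: "nif_scheduling K U N NRF E S"
    and C: "clique (vertices K U) E C"
  shows "(\<Sum>(k, u)\<in>C. slots_served N NRF S k u) \<le> N"
proof -
  have CV: "C \<subseteq> {1..K} \<times> {1..U}"
    using C by (auto simp: clique_def vertices_def)
  then have "finite C" by (rule finite_subset) simp
  define T where "T = (SIGMA v:C. served N NRF S (fst v) (snd v))"
  have "inj_on (\<lambda>(v, r, n). n) T"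
  proof (rule inj_onI, clarify)
    fix k u r n k' u' r'
    assume T: "((k, u), r, n) \<in> T" "((k', u'), r', n) \<in> T"
    have m: "(k, u) \<in> C" "(k', u') \<in> C" "r \<in> {1..NRF}" "r' \<in> {1..NRF}" "n \<in> {1..N}"
      "S k r n = u" "S k' r' n = u'"
      using T by (auto simp: T_def served_def)
    then have K: "k \<in> {1..K}" "k' \<in> {1..K}" "u \<noteq> 0" "u' \<noteq> 0"
      using CV by auto
    have "S k r n * S k' r' n \<noteq> 0"
      using m K by simp
    then have "{(k, S k r n), (k', S k' r' n)} \<notin> E"
      using nif m(3-5) K(1,2) unfolding nif_scheduling_def by blast
    \<comment> \<open>Distinct vertices of a clique would be joined by an edge, which (c) has just
      excluded.\<close>
    then have eq: "(k, u) = (k', u')"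
      using C m(1,2) unfolding clique_def m(6,7) by blast
    then have "S k r n * S k r' n \<noteq> 0"
      using m K by simp
    \<comment> \<open>As both chains serve the same user, the left side is 1, and this forces equal
      chains.\<close>
    then have "delta (S k r n) (S k r' n) = delta r r'"
      using nif m(3-5) K(1) unfolding nif_scheduling_def by simp
    moreover have "S k r n = S k r' n"
      using eq m(6,7) by simp
    ultimately have "r = r'"
      by (simp add: delta_def split: if_splits)
    then show "(k, u) = (k', u') \<and> (r, n) = (r', n)"
      using eq by simp
  qed
  moreover have "(\<lambda>(v, r, n). n) ` T \<subseteq> {1..N}"
    by (auto simp: T_def served_def)
  ultimately have "card T \<le> card {1..N}"
    by (intro card_inj_on_le) auto
  then show ?thesis
    using \<open>finite C\<close> by (simp add: T_def slots_served_eq_card card_SigmaI case_prod_unfold)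
qed

text \<open>A single vertex is a clique. This provides the upper bound \<open>N\<close> that P4
  demands and P3 does not state.\<close>

lemma slots_served_le:
  assumes "nif_scheduling K U N NRF E S" "k \<in> {1..K}" "u \<in> {1..U}"
  shows "slots_served N NRF S k u \<le> N"
  using sum_slots_served_clique_le[OF assms(1), of "{(k, u)}"] assms(2,3)
  by (auto simp: clique_def vertices_def)

text \<open>A position determines the user it serves, so \<open>snd\<close> embeds the disjoint
  union of the served sets into the grid of chains and slots. For infinite \<open>A\<close> the sum
  is 0 by convention.\<close>

lemma sum_slots_served_cell_le:
  "(\<Sum>u\<in>A. slots_served N NRF S k u) \<le> NRF * N"
proof (cases "finite A")
  case True
  have "card (SIGMA u:A. served N NRF S k u) \<le> card ({1..NRF} \<times> {1..N})"
    by (rule card_inj_on_le[where f = snd]) (auto simp: inj_on_def served_def)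
  with True show ?thesis
    by (simp add: slots_served_eq_card card_SigmaI)
qed simp

text \<open>Removes the ceiling and the quotient; the divisor is positive because
  \<open>b * Pmax + 1\<close> exceeds 1. The right side says that \<open>d\<close> slots at full
  power meet the rate requirement.\<close>

lemma min_slots_le_iff:
  assumes "W > 0" "b > 0" "Pmax > 0"
  shows "min_slots N W Pmax g b \<le> int d \<longleftrightarrow>
    g * real N \<le> real d * (W * log 2 (b * Pmax + 1))"
proof -
  have "1 < b * Pmax + 1"
    using assms by simp
  then have "0 < W * log 2 (b * Pmax + 1)"
    using assms(1) by (intro mult_pos_pos zero_less_log_cancel_iff[THEN iffD2]) auto
  then show ?thesis
    by (simp add: min_slots_def ceiling_le_iff pos_divide_le_eq)
qed

text \<open>The slot counts of a schedule serve as the point of P5. Both problems use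
  \<open>slot_cost\<close>, so the objective value is unchanged.\<close>

lemma p5_feasible_if_p4_feasible:
  assumes "p4_feasible K U N NRF E W Pmax \<gamma> \<beta> S"
  shows "p5_feasible K U N NRF E W Pmax \<gamma> \<beta> (\<lambda>k u. real (slots_served N NRF S k u))"
proof -
  have nif: "nif_scheduling K U N NRF E S"
    using assms by (simp add: p4_feasible_def)
  have "(\<Sum>(k, u)\<in>C. real (slots_served N NRF S k u)) \<le> real N"
    if "clique (vertices K U) E C" for C
  proof -
    have "real (\<Sum>(k, u)\<in>C. slots_served N NRF S k u) \<le> real N"
      using sum_slots_served_clique_le[OF nif that] by (simp only: of_nat_le_iff)
    then show ?thesis by (simp add: case_prod_unfold)
  qed
  moreover have "(\<Sum>u\<in>{1..U}. real (slots_served N NRF S k u)) \<le> real (NRF * N)" for k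
    using sum_slots_served_cell_le[of N NRF S k "{1..U}"]
    by (simp only: of_nat_sum[symmetric] of_nat_le_iff)
  moreover have "real_of_int (min_slots N W Pmax (\<gamma> k u) (\<beta> k u)) \<le> real (slots_served N NRF S k u)"
    if "k \<in> {1..K}" "u \<in> {1..U}" for k u
    using assms that unfolding p4_feasible_def
    by (metis of_int_le_iff of_int_of_nat_eq)
  ultimately show ?thesis
    using assms by (simp add: p5_feasible_def p5_relaxed_feasible_def p4_feasible_def)
qed

section \<open>From P3 to P4: power bound by convexity\<close>

lemma log_rate_le:
  assumes "b > 0" "0 \<le> p" "p \<le> (q::real)"
  shows "log 2 (1 + b * p) \<le> log 2 (b * q + 1)"
proof -
  have "0 \<le> b * p" "b * p \<le> b * q"
    using assms by (auto intro: mult_left_mono)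
  then show ?thesis by (subst log_le_cancel_iff) auto
qed

text \<open>In terms of the rates y = \<open>log 2 (1 + b * p i)\<close> the power is (2^y - 1) /
  \<open>b\<close>, a convex function of y, so Jensen's inequality bounds the total by that of equal
  rates.\<close>

lemma user_power_bound:
  fixes p :: "'a \<Rightarrow> real"
  assumes "finite A" "b > 0" "W > 0" "N > 0" "g > 0"
    and p: "\<And>i. i \<in> A \<Longrightarrow> 0 \<le> p i"
    and rate: "g \<le> 1 / real N * (\<Sum>i\<in>A. W * log 2 (1 + b * p i))"
  shows "real (card A) / b * (2 powr (g * real N / (real (card A) * W)) - 1) \<le> (\<Sum>i\<in>A. p i)"
proof -
  \<comment> \<open>The rate per slot and unit bandwidth when the requirement is met exactly and
    split evenly over \<open>A\<close>.\<close>
  define m where "m = g * real N / (real (card A) * W)"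
  \<comment> \<open>An empty sum of rates could not reach the positive \<open>g\<close>; the
    division in \<open>m\<close> is therefore genuine.\<close>
  have "A \<noteq> {}"
    using rate \<open>g > 0\<close> by auto
  then have d: "real (card A) > 0"
    using \<open>finite A\<close> by (simp add: card_gt_0_iff)
  have "g * real N \<le> W * (\<Sum>i\<in>A. log 2 (1 + b * p i))"
    using rate \<open>N > 0\<close> by (simp add: sum_distrib_left[symmetric] field_simps)
  then have "real (card A) * m \<le> (\<Sum>i\<in>A. log 2 (1 + b * p i))"
    using d \<open>W > 0\<close> by (simp add: m_def field_simps)
  then have "real (card A) * 2 powr m \<le> (\<Sum>i\<in>A. 2 powr log 2 (1 + b * p i))"
    using \<open>finite A\<close> by (intro mult_powr_le_sum_powr) auto
  also have "\<dots> = (\<Sum>i\<in>A. 1 + b * p i)"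
  proof (rule sum.cong[OF refl])
    fix i assume "i \<in> A"
    then have "1 + b * p i > 0"
      using p \<open>b > 0\<close> by (simp add: add_pos_nonneg)
    then show "2 powr log 2 (1 + b * p i) = 1 + b * p i" by simp
  qed
  also have "\<dots> = real (card A) + b * (\<Sum>i\<in>A. p i)"
    by (simp add: sum.distrib sum_distrib_left)
  finally show ?thesis
    using \<open>b > 0\<close> unfolding m_def[symmetric] by (simp add: field_simps)
qed

lemma p4_point_of_p3_point:
  assumes "N > 0" "W > 0" "Pmax > 0"
    and \<gamma>: "\<And>k u. k \<in> {1..K} \<Longrightarrow> u \<in> {1..U} \<Longrightarrow> \<gamma> k u > 0"
    and \<beta>: "\<And>k u. k \<in> {1..K} \<Longrightarrow> u \<in> {1..U} \<Longrightarrow> \<beta> k u > 0"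
    and feas: "p3_feasible K U N NRF E W Pmax \<gamma> \<beta> (S, P)"
  shows "p4_feasible K U N NRF E W Pmax \<gamma> \<beta> S"
    and "slot_cost K U N W \<gamma> \<beta> (\<lambda>k u. real (slots_served N NRF S k u))
      \<le> (\<Sum>(k, r, n)\<in>{1..K} \<times> {1..NRF} \<times> {1..N}. P k r n)"
proof -
  have nif: "nif_scheduling K U N NRF E S"
    using feas by (simp add: p3_feasible_def)
  have P: "0 \<le> P k r n" "P k r n \<le> Pmax" if "k \<in> {1..K}" "(r, n) \<in> served N NRF S k u" for k r n u
    using feas that by (auto simp: p3_feasible_def served_def)
  have rate: "\<gamma> k u \<le> 1 / real N * (\<Sum>x\<in>served N NRF S k u. W * log 2 (1 + \<beta> k u * (case x of (r, n) \<Rightarrow> P k r n)))"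
    if "k \<in> {1..K}" "u \<in> {1..U}" for k u
    using feas that unfolding p3_feasible_def served_def by (simp add: case_prod_unfold)
  show "p4_feasible K U N NRF E W Pmax \<gamma> \<beta> S"
    unfolding p4_feasible_def
  proof (intro conjI ballI nif)
    fix k u assume ku: "k \<in> {1..K}" "u \<in> {1..U}"
    show "slots_served N NRF S k u \<le> N"
      using nif ku by (rule slots_served_le)
    \<comment> \<open>Raising every power to \<open>Pmax\<close> only increases the rate, which
      yields the minimal number of slots.\<close>
    have "(\<Sum>x\<in>served N NRF S k u. W * log 2 (1 + \<beta> k u * (case x of (r, n) \<Rightarrow> P k r n)))
        \<le> (\<Sum>x\<in>served N NRF S k u. W * log 2 (\<beta> k u * Pmax + 1))"
      using P ku \<beta> \<open>W > 0\<close>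
      by (intro sum_mono mult_left_mono) (auto intro!: log_rate_le split: prod.split)
    then have "\<gamma> k u * real N \<le> real (slots_served N NRF S k u) * (W * log 2 (\<beta> k u * Pmax + 1))"
      using rate[OF ku] \<open>N > 0\<close> by (simp add: slots_served_eq_card field_simps)
    then show "min_slots N W Pmax (\<gamma> k u) (\<beta> k u) \<le> int (slots_served N NRF S k u)"
      using \<beta>[OF ku] assms by (simp add: min_slots_le_iff)
  qed
  have "slot_cost K U N W \<gamma> \<beta> (\<lambda>k u. real (slots_served N NRF S k u))
      \<le> (\<Sum>(k, u)\<in>{1..K} \<times> {1..U}. \<Sum>(r, n)\<in>served N NRF S k u. P k r n)"
    unfolding slot_cost_def slots_served_eq_card
  proof (intro sum_mono, clarify)
    fix k u assume ku: "k \<in> {1..K}" "u \<in> {1..U}"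
    show "real (card (served N NRF S k u)) / \<beta> k u *
        (2 powr (\<gamma> k u * real N / (real (card (served N NRF S k u)) * W)) - 1)
        \<le> (\<Sum>(r, n)\<in>served N NRF S k u. P k r n)"
      using P[OF ku(1)] rate[OF ku] \<gamma>[OF ku] \<beta>[OF ku] assms(1,2)
      by (intro user_power_bound) auto
  qed
  also have "\<dots> \<le> (\<Sum>(k, r, n)\<in>{1..K} \<times> {1..NRF} \<times> {1..N}. P k r n)"
    unfolding sum_power_by_user[OF nif]
    using P by (auto intro!: sum_nonneg)
  finally show "slot_cost K U N W \<gamma> \<beta> (\<lambda>k u. real (slots_served N NRF S k u))
      \<le> (\<Sum>(k, r, n)\<in>{1..K} \<times> {1..NRF} \<times> {1..N}. P k r n)" .
qed

section \<open>From P4 to P3: equal power in all slots of a user\<close>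

lemma p3_point_of_p4_point:
  assumes "N > 0" "W > 0" "Pmax > 0"
    and \<gamma>: "\<And>k u. k \<in> {1..K} \<Longrightarrow> u \<in> {1..U} \<Longrightarrow> \<gamma> k u > 0"
    and \<beta>: "\<And>k u. k \<in> {1..K} \<Longrightarrow> u \<in> {1..U} \<Longrightarrow> \<beta> k u > 0"
    and feas: "p4_feasible K U N NRF E W Pmax \<gamma> \<beta> S"
  shows "\<exists>P. p3_feasible K U N NRF E W Pmax \<gamma> \<beta> (S, P) \<and>
    (\<Sum>(k, r, n)\<in>{1..K} \<times> {1..NRF} \<times> {1..N}. P k r n) =
      slot_cost K U N W \<gamma> \<beta> (\<lambda>k u. real (slots_served N NRF S k u))"
proof -
  let ?d = "\<lambda>k u. real (slots_served N NRF S k u)"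
  have nif: "nif_scheduling K U N NRF E S"
    using feas by (simp add: p4_feasible_def)
  \<comment> \<open>Solves \<open>W * log 2 (1 + \<beta> k u * p k u) = \<gamma> k u * real N / ?d k
    u\<close>: every slot of the user carries the same share of the requirement.\<close>
  define p where "p k u = (2 powr (\<gamma> k u * real N / (?d k u * W)) - 1) / \<beta> k u" for k u
  \<comment> \<open>Idle positions get zero power, so that they add nothing to the cost.\<close>
  define P where "P k r n = (if S k r n = 0 then 0 else p k (S k r n))" for k r n
  have need: "\<gamma> k u * real N \<le> ?d k u * (W * log 2 (\<beta> k u * Pmax + 1))"
    if "k \<in> {1..K}" "u \<in> {1..U}" for k u
  proof -
    have "min_slots N W Pmax (\<gamma> k u) (\<beta> k u) \<le> int (slots_served N NRF S k u)"
      using feas that by (simp add: p4_feasible_def)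
    then show ?thesis
      using \<beta>[OF that] assms(2,3) by (simp add: min_slots_le_iff)
  qed
  \<comment> \<open>Excludes the value 0 that HOL assigns to division by zero, for which the power
    \<open>p k u\<close> would be 0 and no rate would be achieved.\<close>
  have d: "?d k u > 0" if "k \<in> {1..K}" "u \<in> {1..U}" for k u
  proof (rule ccontr)
    assume "\<not> ?d k u > 0"
    then have "\<gamma> k u * real N \<le> 0"
      using need[OF that] by simp
    then show False
      using \<gamma>[OF that] \<open>N > 0\<close> by (simp add: mult_le_0_iff)
  qed
  have p: "0 \<le> p k u" "p k u \<le> Pmax" if ku: "k \<in> {1..K}" "u \<in> {1..U}" for k u
  proof -
    have "0 \<le> \<gamma> k u * real N / (?d k u * W)"
      using \<gamma>[OF ku] \<open>W > 0\<close> by simp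
    then show "0 \<le> p k u"
      using \<beta>[OF ku] by (simp add: p_def ge_one_powr_ge_zero)
    have "\<gamma> k u * real N / (?d k u * W) \<le> log 2 (\<beta> k u * Pmax + 1)"
      using need[OF ku] d[OF ku] \<open>W > 0\<close> by (simp add: pos_divide_le_eq mult_ac)
    then have "2 powr (\<gamma> k u * real N / (?d k u * W)) \<le> 2 powr log 2 (\<beta> k u * Pmax + 1)"
      by simp
    also have "\<dots> = \<beta> k u * Pmax + 1"
      using \<beta>[OF ku] \<open>Pmax > 0\<close> by (simp add: add_pos_pos)
    finally show "p k u \<le> Pmax"
      using \<beta>[OF ku] by (simp add: p_def pos_divide_le_eq mult.commute)
  qed
  \<comment> \<open>A general \<open>f\<close> covers both later uses: the rate, and the power
    itself.\<close>
  have P_served: "(case x of (r, n) \<Rightarrow> f (P k r n)) = f (p k u)"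
    if "x \<in> served N NRF S k u" "u \<in> {1..U}" for x k u and f :: "real \<Rightarrow> real"
    using that by (auto simp: P_def served_def)
  have "p3_feasible K U N NRF E W Pmax \<gamma> \<beta> (S, P)"
    unfolding p3_feasible_def split
  proof (intro conjI ballI nif)
    fix k r n assume krn: "k \<in> {1..K}" "r \<in> {1..NRF}" "n \<in> {1..N}"
    then have "S k r n \<in> {0..U}"
      using nif by (simp add: nif_scheduling_def)
    then show "0 \<le> P k r n" "P k r n \<le> Pmax"
      using p[OF krn(1), of "S k r n"] \<open>Pmax > 0\<close> by (auto simp: P_def)
  next
    fix k u assume ku: "k \<in> {1..K}" "u \<in> {1..U}"
    have "(\<Sum>(r, n)\<in>served N NRF S k u. W * log 2 (1 + \<beta> k u * P k r n)) =
        (\<Sum>x\<in>served N NRF S k u. W * log 2 (1 + \<beta> k u * p k u))"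
      using ku by (intro sum.cong refl P_served)
    also have "\<dots> = ?d k u * (W * (\<gamma> k u * real N / (?d k u * W)))"
      using \<beta>[OF ku] by (simp add: slots_served_eq_card p_def)
    also have "\<dots> = \<gamma> k u * real N"
      using d[OF ku] \<open>W > 0\<close> by simp
    finally show "\<gamma> k u \<le> 1 / real N *
        (\<Sum>(r, n)\<in>{(r, n). r \<in> {1..NRF} \<and> n \<in> {1..N} \<and> S k r n = u}. W * log 2 (1 + \<beta> k u * P k r n))"
      using \<open>N > 0\<close> unfolding served_def by simp
  qed
  moreover have "(\<Sum>(k, r, n)\<in>{1..K} \<times> {1..NRF} \<times> {1..N}. P k r n) = slot_cost K U N W \<gamma> \<beta> ?d"
  proof -
    have "(\<Sum>(r, n)\<in>served N NRF S k 0. P k r n) = 0" for k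
      by (intro sum.neutral) (auto simp: P_def served_def)
    moreover have "(\<Sum>(r, n)\<in>served N NRF S k u. P k r n) =
        ?d k u / \<beta> k u * (2 powr (\<gamma> k u * real N / (?d k u * W)) - 1)" if "u \<in> {1..U}" for k u
    proof -
      have "(\<Sum>(r, n)\<in>served N NRF S k u. P k r n) = (\<Sum>x\<in>served N NRF S k u. p k u)"
        using that by (intro sum.cong refl P_served)
      then show ?thesis by (simp add: slots_served_eq_card p_def)
    qed
    ultimately show ?thesis
      unfolding sum_power_by_user[OF nif] slot_cost_def
      by (auto intro!: sum.cong)
  qed
  ultimately show ?thesis by blast
qed

section \<open>Comparison of the optimal values\<close>

theorem mainTheorem3:
  fixes K U N NRF :: nat
    and E :: "(nat \<times> nat) set set"
    and W Pmax :: real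
    and \<gamma> \<beta> :: "nat \<Rightarrow> nat \<Rightarrow> real"
  assumes "K > 0" and "U > 0" and "N > 0" and "NRF > 0"
    and "simple_graph (vertices K U) E"
    and "W > 0" and "Pmax > 0"
    and "\<And>k u. k \<in> {1..K} \<Longrightarrow> u \<in> {1..U} \<Longrightarrow> \<gamma> k u > 0"
    and "\<And>k u. k \<in> {1..K} \<Longrightarrow> u \<in> {1..U} \<Longrightarrow> \<beta> k u > 0"
  shows "p3_opt K U N NRF E W Pmax \<gamma> \<beta> = p4_opt K U N NRF E W Pmax \<gamma> \<beta> \<and>
         p5_relaxed_opt K U N NRF E W Pmax \<gamma> \<beta> \<le> p5_opt K U N NRF E W Pmax \<gamma> \<beta> \<and>
         p5_opt K U N NRF E W Pmax \<gamma> \<beta> \<le> p4_opt K U N NRF E W Pmax \<gamma> \<beta> \<and>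
         p5_relaxed_opt K U N NRF E W Pmax \<gamma> \<beta> \<le> p3_opt K U N NRF E W Pmax \<gamma> \<beta>"
proof -
  have "p3_opt K U N NRF E W Pmax \<gamma> \<beta> \<le> p4_opt K U N NRF E W Pmax \<gamma> \<beta>"
    unfolding p3_opt_def p4_opt_def
  proof (rule optimal_value_mono)
    fix S assume "p4_feasible K U N NRF E W Pmax \<gamma> \<beta> S"
    then obtain P where "p3_feasible K U N NRF E W Pmax \<gamma> \<beta> (S, P)"
      "(\<Sum>(k, r, n)\<in>{1..K} \<times> {1..NRF} \<times> {1..N}. P k r n) =
        slot_cost K U N W \<gamma> \<beta> (\<lambda>k u. real (slots_served N NRF S k u))"
      using p3_point_of_p4_point[where K = K and U = U and \<gamma> = \<gamma> and \<beta> = \<beta>, OF assms(3,6-9)] by blast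
    then show "\<exists>y. p3_feasible K U N NRF E W Pmax \<gamma> \<beta> y \<and>
        (case y of (S, P) \<Rightarrow> \<Sum>(k, r, n)\<in>{1..K} \<times> {1..NRF} \<times> {1..N}. P k r n)
        \<le> slot_cost K U N W \<gamma> \<beta> (\<lambda>k u. real (slots_served N NRF S k u))"
      by (intro exI[of _ "(S, P)"]) simp
  qed
  moreover have "p4_opt K U N NRF E W Pmax \<gamma> \<beta> \<le> p3_opt K U N NRF E W Pmax \<gamma> \<beta>"
    unfolding p3_opt_def p4_opt_def
  proof (rule optimal_value_mono, clarify)
    fix S P assume "p3_feasible K U N NRF E W Pmax \<gamma> \<beta> (S, P)"
    from p4_point_of_p3_point[where K = K and U = U and \<gamma> = \<gamma> and \<beta> = \<beta>, OF assms(3,6-9) this]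
    show "\<exists>y. p4_feasible K U N NRF E W Pmax \<gamma> \<beta> y \<and>
        slot_cost K U N W \<gamma> \<beta> (\<lambda>k u. real (slots_served N NRF y k u))
        \<le> (\<Sum>(k, r, n)\<in>{1..K} \<times> {1..NRF} \<times> {1..N}. P k r n)"
      by blast
  qed
  \<comment> \<open>Relaxing integrality enlarges the feasible set and keeps the cost, so each point
    dominates itself.\<close>
  moreover have "p5_relaxed_opt K U N NRF E W Pmax \<gamma> \<beta> \<le> p5_opt K U N NRF E W Pmax \<gamma> \<beta>"
    unfolding p5_relaxed_opt_def p5_opt_def
    by (rule optimal_value_mono) (auto simp: p5_feasible_def)
  moreover have "p5_opt K U N NRF E W Pmax \<gamma> \<beta> \<le> p4_opt K U N NRF E W Pmax \<gamma> \<beta>"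
    unfolding p5_opt_def p4_opt_def
    by (rule optimal_value_mono) (blast intro: p5_feasible_if_p4_feasible)
  ultimately show ?thesis by auto
qed

end
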